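(* The power $\frac{m+1}{2}$ in the Kahane--Salem--Zygmund inequality is optimal for both real and complex scalars. That is, let $\mathbb{K}=\mathbb{R}$ or $\mathbb{C}$, let $m\ge2$ be an integer and let $q<\frac{m+1}{2}$. Then there is no constant $C>0$ such that for every positive integer $n$ there exist signs $\varepsilon_\alpha\in\{-1,1\}$ $(|\alpha|=m)$ for which the $m$-homogeneous polynomial $$P_{m,n}:\ell_\infty^n(\mathbb{K})\to\mathbb{K},\qquad P_{m,n}(z)=\sum_{|\alpha|=m}\varepsilon_\alpha z^\alpha,$$ satisfies $$\|P_{m,n}\|\le C\,n^{q}\sqrt{\log m}.$$
   Context: $\ell_\infty^n(\mathbb{K})$ is $\mathbb{K}^n$ with the sup norm and $\|P\|=\sup\{|P(z)|:\|z\|_\infty\le1\}$. For a multi-index $\alpha=(\alpha_1,\ldots,\alpha_n)$ of nonnegative integers, $|\alpha|=\alpha_1+\cdots+\alpha_n$ and $z^\alpha=z_1^{\alpha_1}\cdots z_n^{\alpha_n}$. The Kahane--Salem--Zygmund inequality states that there is a universal constant $C>0$ (independent of $m$ and $n$) such that for all $m\ge 2$, $n\ge 1$ there are signs $\varepsilon_\alpha=\pm1$ for which $P_{m,n}(z)=\sum_{|\alpha|=m}\varepsilon_\alpha z^\alpha$ satisfies $\|P_{m,n}\|\le C n^{(m+1)/2}\sqrt{\log m}$. *)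

theory Defs
  imports Complex_Main
begin

text \<open>
  The dimension \<open>n\<close> is quantified inside the statement, so points of \<open>\<bbbK>\<^sup>n\<close> and multi-indices are
  functions on \<open>nat\<close>, with coordinates numbered \<open>0, \<dots>, n - 1\<close>. For points \<open>z\<close> the values
  \<open>z i\<close> with \<open>i \<ge> n\<close> are irrelevant; for multi-indices they are fixed to be \<open>0\<close>, so that each
  multi-index is represented exactly once.
\<close>

definition multi_indices :: "nat \<Rightarrow> nat \<Rightarrow> (nat \<Rightarrow> nat) set" where
  "multi_indices n m = {\<alpha>. (\<forall>i\<ge>n. \<alpha> i = 0) \<and> (\<Sum>i<n. \<alpha> i) = m}"

definition monomial :: "nat \<Rightarrow> (nat \<Rightarrow> nat) \<Rightarrow> (nat \<Rightarrow> 'a) \<Rightarrow> 'a::comm_monoid_mult" where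
  "monomial n \<alpha> z = (\<Prod>i<n. z i ^ \<alpha> i)"

definition hom_poly :: "nat \<Rightarrow> nat \<Rightarrow> ((nat \<Rightarrow> nat) \<Rightarrow> 'a) \<Rightarrow> (nat \<Rightarrow> 'a) \<Rightarrow> 'a::comm_semiring_1" where
  "hom_poly m n c z = (\<Sum>\<alpha>\<in>multi_indices n m. c \<alpha> * monomial n \<alpha> z)"

text \<open>The supremum norm on \<open>\<bbbK>\<^sup>n\<close>; meaningful for \<open>n \<ge> 1\<close>.\<close>

definition linf_norm :: "nat \<Rightarrow> (nat \<Rightarrow> 'a::real_normed_vector) \<Rightarrow> real" where
  "linf_norm n z = Max ((\<lambda>i. norm (z i)) ` {..<n})"

definition poly_norm :: "nat \<Rightarrow> ((nat \<Rightarrow> 'a::real_normed_vector) \<Rightarrow> 'b::real_normed_vector) \<Rightarrow> real" where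
  "poly_norm n P = Sup {norm (P z) | z. linf_norm n z \<le> 1}"

text \<open>
  The following facts ensure that neither the finite sum in \<^const>\<open>hom_poly\<close> nor the real
  supremum in \<^const>\<open>poly_norm\<close> takes a default value.
\<close>

lemma finite_multi_indices: "finite (multi_indices n m)"
proof (rule finite_subset)
  show "multi_indices n m \<subseteq> {\<alpha>. \<forall>i. (i \<in> {..<n} \<longrightarrow> \<alpha> i \<in> {..m}) \<and> (i \<notin> {..<n} \<longrightarrow> \<alpha> i = 0)}"
    by (auto simp: multi_indices_def intro: member_le_sum)
  show "finite {\<alpha>. \<forall>i. (i \<in> {..<n} \<longrightarrow> \<alpha> i \<in> {..m}) \<and> (i \<notin> {..<n} \<longrightarrow> \<alpha> i = (0::nat))}"
    by (rule finite_set_of_finite_funs) auto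
qed

lemma linf_norm_le_iff: "n \<ge> 1 \<Longrightarrow> linf_norm n z \<le> r \<longleftrightarrow> (\<forall>i<n. norm (z i) \<le> r)"
  unfolding linf_norm_def by (subst Max_le_iff) (auto simp: lessThan_empty_iff)

lemma poly_norm_set_nonempty:
  fixes P :: "(nat \<Rightarrow> 'a::real_normed_vector) \<Rightarrow> 'b::real_normed_vector"
  assumes "n \<ge> 1"
  shows "{norm (P z) | z. linf_norm n z \<le> 1} \<noteq> {}"
proof -
  have "linf_norm n (\<lambda>_. 0 :: 'a) \<le> 1"
    using assms by (simp add: linf_norm_le_iff)
  then show ?thesis by blast
qed

lemma bdd_above_hom_poly:
  fixes c :: "(nat \<Rightarrow> nat) \<Rightarrow> 'a::real_normed_field"
  assumes "n \<ge> 1"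
  shows "bdd_above {norm (hom_poly m n c z) | z. linf_norm n z \<le> 1}"
proof -
  have "norm (hom_poly m n c z) \<le> (\<Sum>\<alpha>\<in>multi_indices n m. norm (c \<alpha>))"
    if z: "linf_norm n z \<le> 1" for z
  proof -
    have "norm (monomial n \<alpha> z) \<le> 1" for \<alpha>
      unfolding monomial_def prod_norm[symmetric] norm_power
      using z assms by (intro prod_le_1) (auto simp: linf_norm_le_iff norm_power intro: power_le_one)
    then show ?thesis
      unfolding hom_poly_def
      by (intro order.trans[OF norm_sum] sum_mono) (simp add: norm_mult mult_left_le)
  qed
  then show ?thesis by (auto intro!: bdd_aboveI)
qed

end

theory Submission
  imports Defs "HOL-Library.FuncSet" "HOL-Analysis.Convex"
begin

text \<open>
  For fixed \<open>m\<close>, every polynomial \<open>P = \<Sum> \<epsilon>\<^sub>\<alpha> z\<^sup>\<alpha>\<close> with signs \<open>\<epsilon>\<^sub>\<alpha>\<close> has norm at least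
  \<open>c\<^sub>m n\<^bsup>(m+1)/2\<^esup>\<close> for all \<open>n\<close> divisible by \<open>m\<close>, because some point of the real cube \<open>[-1, 1]\<^sup>n\<close>
  makes \<open>P\<close> that large. As the coefficients are real and real points belong to the complex unit
  ball, the real estimate settles both scalar fields.

  Let \<open>n = m k\<close> and split the variables into \<open>m\<close> blocks of size \<open>k\<close>. Multiply each block by a
  sign \<open>s\<^sub>b\<close> and average \<open>s\<^sub>1 \<cdots> s\<^sub>m P\<close> over all choices of signs: only monomials whose degree in
  every block is odd survive, and in total degree \<open>m\<close> these are the products of exactly one
  variable from each block. So the multilinear part \<open>Q\<close> of \<open>P\<close> belonging to the transversals of
  the blocks satisfies \<open>\<bar>Q\<bar> \<le> \<parallel>P\<parallel>\<close> on the cube (lemma \<open>transversal_part_bound\<close>).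

  Now write \<open>Q = \<Sum>\<^sub>j z\<^sub>j Q\<^sub>j(x)\<close>, where \<open>j\<close> runs over one distinguished block and \<open>x\<close> collects
  the variables of the others. Choosing \<open>z\<^sub>j = sgn Q\<^sub>j(x)\<close> gives \<open>\<Sum>\<^sub>j \<bar>Q\<^sub>j(x)\<bar> \<le> \<parallel>P\<parallel>\<close> for every sign
  vector \<open>x\<close>. Averaging over \<open>x\<close>, it remains to bound the mean of \<open>\<bar>Q\<^sub>j\<bar>\<close> from below. By
  orthogonality of Walsh functions \<open>Q\<^sub>j\<close> has mean square \<open>k\<^bsup>m-1\<^esup>\<close>, and by hypercontractivity
  its fourth moment is at most a constant times the square of its second
  (lemma \<open>walsh_fourth_moment\<close>), so the mean of \<open>\<bar>Q\<^sub>j\<bar>\<close> is at least \<open>c k\<^bsup>(m-1)/2\<^esup>\<close>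
  (lemma \<open>walsh_first_moment\<close>). Summing over the \<open>k\<close> values of \<open>j\<close> gives \<open>\<parallel>P\<parallel> \<ge> c k\<^bsup>(m+1)/2\<^esup>\<close>.
\<close>

section \<open>Averages over the discrete cube\<close>

definition sign_vec :: "'i set \<Rightarrow> 'i \<Rightarrow> real" where
  "sign_vec T i = (if i \<in> T then -1 else 1)"

text \<open>
  The expectation over independent uniform signs for the coordinates in \<open>V\<close>. Coordinates outside
  \<open>V\<close> are set to \<open>1\<close>, so the functions averaged here should depend on \<open>V\<close> only.
\<close>

definition cube_mean :: "'i set \<Rightarrow> (('i \<Rightarrow> real) \<Rightarrow> real) \<Rightarrow> real" where
  "cube_mean V f = (\<Sum>T\<in>Pow V. f (sign_vec T)) / 2 ^ card V"

lemma sum_Pow_insert: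
  assumes "finite V" "v \<notin> V"
  shows "(\<Sum>S\<in>Pow (insert v V). f S) = (\<Sum>S\<in>Pow V. f S) + (\<Sum>S\<in>Pow V. f (insert v S))"
proof -
  have "(\<Sum>S\<in>insert v ` Pow V. f S) = (\<Sum>S\<in>Pow V. f (insert v S))"
    using assms by (subst sum.reindex) (auto simp: inj_on_def)
  then show ?thesis
    unfolding Pow_insert using assms by (subst sum.union_disjoint) auto
qed

lemma sign_vec_update:
  "v \<notin> T \<Longrightarrow> (sign_vec T)(v := 1) = sign_vec T"
  "(sign_vec T)(v := -1) = sign_vec (insert v T)"
  by (auto simp: sign_vec_def fun_eq_iff)

lemma cube_mean_empty: "cube_mean {} f = f (\<lambda>_. 1)"
  by (simp add: cube_mean_def sign_vec_def[abs_def])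

text \<open>
  Fubini for one coordinate; the moment computations below are inductions along this rule.
\<close>

lemma cube_mean_insert:
  assumes "finite V" "v \<notin> V"
  shows "cube_mean (insert v V) f = cube_mean V (\<lambda>x. (f (x(v := 1)) + f (x(v := -1))) / 2)"
proof -
  have "(\<Sum>T\<in>Pow V. f (sign_vec T)) = (\<Sum>T\<in>Pow V. f ((sign_vec T)(v := 1)))"
    using assms by (intro sum.cong) (auto simp: sign_vec_update(1)[OF contra_subsetD[OF _ assms(2)]])
  then show ?thesis
    using assms unfolding cube_mean_def sum_Pow_insert[OF assms]
    by (simp add: sign_vec_update sum.distrib del: fun_upd_apply flip: sum_divide_distrib)
qed

lemma cube_mean_mono:
  "(\<And>x. (\<And>i. x i = 1 \<or> x i = -1) \<Longrightarrow> f x \<le> g x) \<Longrightarrow> cube_mean V f \<le> cube_mean V g"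
  unfolding cube_mean_def by (intro divide_right_mono sum_mono) (auto simp: sign_vec_def)

lemma cube_mean_const: "finite V \<Longrightarrow> cube_mean V (\<lambda>_. c) = c"
  by (simp add: cube_mean_def card_Pow)

lemma cube_mean_add: "cube_mean V (\<lambda>x. f x + g x) = cube_mean V f + cube_mean V g"
  by (simp add: cube_mean_def sum.distrib add_divide_distrib)

lemma cube_mean_diff: "cube_mean V (\<lambda>x. f x - g x) = cube_mean V f - cube_mean V g"
  by (simp add: cube_mean_def sum_subtractf diff_divide_distrib)

lemma cube_mean_cmult: "cube_mean V (\<lambda>x. c * f x) = c * cube_mean V f"
  by (simp add: cube_mean_def sum_distrib_left)

lemma cube_mean_sum: "cube_mean V (\<lambda>x. \<Sum>j\<in>J. f j x) = (\<Sum>j\<in>J. cube_mean V (f j))"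
  unfolding cube_mean_def by (subst sum.swap) (simp add: sum_divide_distrib)

lemma cube_mean_abs_le:
  assumes "finite V" "\<And>x. (\<And>i. x i = 1 \<or> x i = -1) \<Longrightarrow> \<bar>f x\<bar> \<le> K"
  shows "\<bar>cube_mean V f\<bar> \<le> K"
proof -
  have "cube_mean V f \<le> cube_mean V (\<lambda>_. K)" "cube_mean V (\<lambda>_. - K) \<le> cube_mean V f"
    using assms(2) by (intro cube_mean_mono; meson abs_le_D1 abs_le_D2 minus_le_iff)+
  then show ?thesis using assms(1) by (simp add: cube_mean_const)
qed

lemma cube_mean_monomial:
  assumes "finite V"
  shows "cube_mean V (\<lambda>x. \<Prod>i\<in>V. x i ^ e i) = (if \<forall>i\<in>V. even (e i) then 1 else 0)"
  using assms
proof (induction V rule: finite_induct)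
  case empty
  then show ?case by (simp add: cube_mean_empty)
next
  case (insert v V)
  have *: "(\<Prod>i\<in>V. (x(v := c)) i ^ e i) = (\<Prod>i\<in>V. x i ^ e i)" for x :: "'a \<Rightarrow> real" and c
    using insert by (intro prod.cong) auto
  have "cube_mean (insert v V) (\<lambda>x. \<Prod>i\<in>insert v V. x i ^ e i)
      = (1 + (-1) ^ e v) / 2 * cube_mean V (\<lambda>x. \<Prod>i\<in>V. x i ^ e i)"
    using insert.hyps unfolding cube_mean_cmult[symmetric]
    by (simp add: cube_mean_insert * del: fun_upd_apply) (simp add: field_simps)
  then show ?case unfolding insert.IH by (cases "\<forall>i\<in>V. even (e i)") auto
qed

section \<open>Moments of Walsh polynomials\<close>

definition walsh_sum :: "'i set \<Rightarrow> ('i set \<Rightarrow> real) \<Rightarrow> ('i \<Rightarrow> real) \<Rightarrow> real" where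
  "walsh_sum V a x = (\<Sum>S\<in>Pow V. a S * (\<Prod>i\<in>S. x i))"

lemma walsh_sum_insert:
  assumes "finite V" "v \<notin> V"
  shows "walsh_sum (insert v V) a (x(v := c))
       = walsh_sum V a x + c * walsh_sum V (\<lambda>S. a (insert v S)) x"
proof -
  let ?f = "\<lambda>S. a S * (\<Prod>i\<in>S. (x(v := c)) i)"
  have eq: "(\<Prod>i\<in>S. (x(v := c)) i) = (\<Prod>i\<in>S. x i)" if "S \<subseteq> V" for S
    using that assms by (intro prod.cong) auto
  have "(\<Sum>S\<in>Pow V. ?f (insert v S)) = (\<Sum>S\<in>Pow V. c * (a (insert v S) * (\<Prod>i\<in>S. x i)))"
  proof (intro sum.cong refl)
    fix S assume "S \<in> Pow V"
    then have "S \<subseteq> V" "finite S" "v \<notin> S" using assms finite_subset by auto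
    then show "?f (insert v S) = c * (a (insert v S) * (\<Prod>i\<in>S. x i))"
      using eq[of S] by (simp del: fun_upd_apply) simp
  qed
  moreover have "sum ?f (Pow V) = walsh_sum V a x"
    unfolding walsh_sum_def by (intro sum.cong) (auto simp: eq simp del: fun_upd_apply)
  ultimately show ?thesis
    by (simp add: walsh_sum_def sum_Pow_insert[OF assms] sum_distrib_left del: fun_upd_apply)
qed

text \<open>
  Parseval's identity. Splitting off a coordinate writes the polynomial as \<open>G + x\<^sub>v H\<close>, and the
  cross term averages to \<open>0\<close> over \<open>x\<^sub>v = \<plusminus>1\<close>.
\<close>

lemma walsh_second_moment:
  assumes "finite V"
  shows "cube_mean V (\<lambda>x. (walsh_sum V a x)\<^sup>2) = (\<Sum>S\<in>Pow V. (a S)\<^sup>2)"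
  using assms
proof (induction V arbitrary: a rule: finite_induct)
  case empty
  then show ?case by (simp add: cube_mean_empty walsh_sum_def)
next
  case (insert v V)
  let ?b = "\<lambda>S. a (insert v S)"
  have parallelogram: "((g + h)\<^sup>2 + (g - h)\<^sup>2) / 2 = g\<^sup>2 + h\<^sup>2" for g h :: real
    by (simp add: power2_eq_square field_simps)
  have "cube_mean (insert v V) (\<lambda>x. (walsh_sum (insert v V) a x)\<^sup>2)
      = cube_mean V (\<lambda>x. (walsh_sum V a x)\<^sup>2 + (walsh_sum V ?b x)\<^sup>2)"
    using insert.hyps by (simp add: cube_mean_insert walsh_sum_insert parallelogram del: fun_upd_apply)
  then show ?case
    using insert by (simp add: cube_mean_add insert.IH sum_Pow_insert)
qed

lemma cube_mean_Cauchy_Schwarz: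
  "(cube_mean V (\<lambda>x. f x * g x))\<^sup>2 \<le> cube_mean V (\<lambda>x. (f x)\<^sup>2) * cube_mean V (\<lambda>x. (g x)\<^sup>2)"
  unfolding cube_mean_def power_divide
  using Cauchy_Schwarz_ineq_sum[of "\<lambda>T. f (sign_vec T)" "\<lambda>T. g (sign_vec T)" "Pow V"]
  by (simp add: divide_right_mono power2_eq_square)

text \<open>
  Bonami's hypercontractive inequality. For \<open>G + x\<^sub>v H\<close>, averaging over \<open>x\<^sub>v\<close> leaves
  \<open>G\<^sup>4 + 6 G\<^sup>2 H\<^sup>2 + H\<^sup>4\<close>. Since \<open>H\<close> has degree at most \<open>d - 1\<close>, its fourth moment carries a spare
  factor \<open>1/9\<close>; after Cauchy-Schwarz this factor turns the middle term into exactly the cross term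
  \<open>2 A B\<close> of \<open>9\<^sup>d (A + B)\<^sup>2\<close>.
\<close>

lemma walsh_fourth_moment:
  assumes "finite V" "\<And>S. S \<subseteq> V \<Longrightarrow> card S > d \<Longrightarrow> a S = 0"
  shows "cube_mean V (\<lambda>x. (walsh_sum V a x) ^ 4) \<le> 9 ^ d * (\<Sum>S\<in>Pow V. (a S)\<^sup>2)\<^sup>2"
  using assms
proof (induction V arbitrary: a d rule: finite_induct)
  case empty
  have "1 * a {} ^ 4 \<le> 9 ^ d * a {} ^ 4"
    by (intro mult_right_mono) auto
  then show ?case by (simp add: cube_mean_empty walsh_sum_def flip: power_mult)
next
  case (insert v V)
  define b where "b = (\<lambda>S. a (insert v S))"
  define G H where "G = walsh_sum V a" and "H = walsh_sum V b"
  define A B where "A = (\<Sum>S\<in>Pow V. (a S)\<^sup>2)" and "B = (\<Sum>S\<in>Pow V. (b S)\<^sup>2)"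
  have nonneg: "A \<ge> 0" "B \<ge> 0" by (auto simp: A_def B_def intro: sum_nonneg)
  have even_part: "((g + h) ^ 4 + (g - h) ^ 4) / 2 = g ^ 4 + 6 * (g\<^sup>2 * h\<^sup>2) + h ^ 4" for g h :: real
    by (simp add: power4_eq_xxxx power2_eq_square field_simps)
  have GH: "walsh_sum (insert v V) a (x(v := c)) = G x + c * H x" for x c
    using insert by (simp add: G_def H_def b_def walsh_sum_insert del: fun_upd_apply)
  have "cube_mean (insert v V) (\<lambda>x. (walsh_sum (insert v V) a x) ^ 4)
      = cube_mean V (\<lambda>x. G x ^ 4 + 6 * ((G x)\<^sup>2 * (H x)\<^sup>2) + H x ^ 4)"
    using insert.hyps by (simp add: cube_mean_insert GH even_part del: fun_upd_apply)
  also have "\<dots> = cube_mean V (\<lambda>x. G x ^ 4) + 6 * cube_mean V (\<lambda>x. (G x)\<^sup>2 * (H x)\<^sup>2)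
      + cube_mean V (\<lambda>x. H x ^ 4)"
    by (simp add: cube_mean_add cube_mean_cmult)
  also have "\<dots> \<le> 9 ^ d * (A + B)\<^sup>2"
  proof (cases d)
    case 0
    have "b S = 0" if "S \<subseteq> V" for S
      unfolding b_def using that insert 0 by (intro insert.prems) (auto simp: card_gt_0_iff finite_subset)
    then have "H x = 0" for x by (simp add: H_def walsh_sum_def)
    have "cube_mean V (\<lambda>x. G x ^ 4) \<le> 9 ^ d * A\<^sup>2"
      unfolding G_def A_def using insert.prems by (intro insert.IH) auto
    moreover have "9 ^ d * A\<^sup>2 \<le> 9 ^ d * (A + B)\<^sup>2"
      using nonneg by (intro mult_left_mono power_mono) auto
    ultimately have "cube_mean V (\<lambda>x. G x ^ 4) \<le> 9 ^ d * (A + B)\<^sup>2" by (rule order_trans)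
    with \<open>\<And>x. H x = 0\<close> show ?thesis by (simp add: cube_mean_const insert.hyps)
  next
    case (Suc e)
    have G4: "cube_mean V (\<lambda>x. G x ^ 4) \<le> 9 ^ d * A\<^sup>2"
      unfolding G_def A_def using insert.prems by (intro insert.IH) auto
    have H4: "cube_mean V (\<lambda>x. H x ^ 4) \<le> 9 ^ e * B\<^sup>2"
      unfolding H_def B_def
    proof (intro insert.IH)
      fix S assume "S \<subseteq> V" "e < card S"
      moreover from this have "finite S" "v \<notin> S" using insert finite_subset by auto
      ultimately show "b S = 0"
        unfolding b_def using Suc by (intro insert.prems) auto
    qed
    have "(cube_mean V (\<lambda>x. (G x)\<^sup>2 * (H x)\<^sup>2))\<^sup>2
        \<le> cube_mean V (\<lambda>x. G x ^ 4) * cube_mean V (\<lambda>x. H x ^ 4)"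
      using cube_mean_Cauchy_Schwarz[of V "\<lambda>x. (G x)\<^sup>2" "\<lambda>x. (H x)\<^sup>2"] by (simp flip: power_mult)
    also have "\<dots> \<le> (9 ^ d * A\<^sup>2) * (9 ^ e * B\<^sup>2)"
    proof (intro mult_mono G4 H4)
      show "0 \<le> cube_mean V (\<lambda>x. H x ^ 4)"
        unfolding cube_mean_def by (intro divide_nonneg_nonneg sum_nonneg) auto
    qed (simp)
    also have "\<dots> = (3 * 9 ^ e * A * B)\<^sup>2"
      by (simp add: Suc power2_eq_square)
    finally have "cube_mean V (\<lambda>x. (G x)\<^sup>2 * (H x)\<^sup>2) \<le> 3 * 9 ^ e * A * B"
      by (rule power2_le_imp_le) (use nonneg in simp)
    with G4 H4 have "cube_mean V (\<lambda>x. G x ^ 4) + 6 * cube_mean V (\<lambda>x. (G x)\<^sup>2 * (H x)\<^sup>2)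
        + cube_mean V (\<lambda>x. H x ^ 4) \<le> 9 ^ d * A\<^sup>2 + 6 * (3 * 9 ^ e * A * B) + 9 ^ e * B\<^sup>2"
      by linarith
    also have "\<dots> \<le> 9 ^ d * A\<^sup>2 + 6 * (3 * 9 ^ e * A * B) + 9 ^ d * B\<^sup>2"
      by (simp add: Suc)
    also have "\<dots> = 9 ^ d * (A + B)\<^sup>2"
      by (simp add: Suc power2_eq_square algebra_simps)
    finally show ?thesis .
  qed
  finally show ?case
    using insert.hyps by (simp add: A_def B_def b_def sum_Pow_insert)
qed

text \<open>
  A function whose fourth moment is controlled by its second cannot be concentrated on a small set,
  so its first moment is comparable to its \<open>L\<^sup>2\<close> norm. To see this, take the mean of
  \<open>t\<^sup>2 / s - t\<^sup>4 / s\<^sup>3 \<le> \<bar>t\<bar>\<close>, which holds for every \<open>s > 0\<close>.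
\<close>

lemma walsh_first_moment:
  assumes V: "finite V" and deg: "\<And>S. S \<subseteq> V \<Longrightarrow> card S > d \<Longrightarrow> a S = 0"
  shows "sqrt (\<Sum>S\<in>Pow V. (a S)\<^sup>2) / (2 * sqrt 2 * 3 ^ d) \<le> cube_mean V (\<lambda>x. \<bar>walsh_sum V a x\<bar>)"
proof -
  define A where "A = (\<Sum>S\<in>Pow V. (a S)\<^sup>2)"
  \<comment> \<open>At this scale the bound on the fourth-moment term is half of the second-moment term.\<close>
  define s where "s = sqrt (2 * A) * 3 ^ d"
  have "A \<ge> 0" unfolding A_def by (intro sum_nonneg) auto
  show ?thesis
  proof (cases "A = 0")
    case True
    have "cube_mean V (\<lambda>_. 0) \<le> cube_mean V (\<lambda>x. \<bar>walsh_sum V a x\<bar>)"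
      by (intro cube_mean_mono) auto
    then show ?thesis using True V by (simp add: A_def cube_mean_const)
  next
    case False
    with \<open>A \<ge> 0\<close> have "A > 0" "s > 0" by (simp_all add: s_def)
    have s2: "s\<^sup>2 = 2 * 9 ^ d * A"
      using \<open>A > 0\<close> power_mult_distrib[of "3::real" 3 d]
      by (simp add: s_def power_mult_distrib power2_eq_square[of "3 ^ d"])
    have pointwise: "t\<^sup>2 / s - t ^ 4 / s ^ 3 \<le> \<bar>t\<bar>" for t :: real
    proof -
      define u where "u = \<bar>t\<bar> / s"
      have "u \<ge> 0" using \<open>s > 0\<close> by (simp add: u_def)
      have "u \<le> 1 + u ^ 3"
      proof (cases "u \<le> 1")
        case False
        then have "u ^ 1 \<le> u ^ 3" by (intro power_increasing) auto
        then show ?thesis by simp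
      qed (use \<open>u \<ge> 0\<close> in \<open>simp add: add_increasing2\<close>)
      then have "s * u * u \<le> s * u * (1 + u ^ 3)"
        using \<open>s > 0\<close> \<open>u \<ge> 0\<close> by (intro mult_left_mono) auto
      then have "s * u\<^sup>2 - s * u ^ 4 \<le> s * u"
        by (simp add: algebra_simps power2_eq_square power4_eq_xxxx power3_eq_cube)
      moreover have "t\<^sup>2 / s = s * u\<^sup>2"
        using \<open>s > 0\<close> by (simp add: u_def power_divide power2_eq_square)
      moreover have "t ^ 4 / s ^ 3 = s * u ^ 4"
        using \<open>s > 0\<close> by (simp add: u_def power_divide power3_eq_cube power4_eq_xxxx)
      moreover have "\<bar>t\<bar> = s * u"
        using \<open>s > 0\<close> by (simp add: u_def)
      ultimately show ?thesis by simp
    qed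
    have "sqrt A / (2 * sqrt 2 * 3 ^ d) = A / s - 9 ^ d * A\<^sup>2 / s ^ 3"
    proof -
      have "9 ^ d * A\<^sup>2 / s ^ 3 = A / s * (9 ^ d * A / s\<^sup>2)"
        by (simp add: power2_eq_square power3_eq_cube mult_ac)
      also have "9 ^ d * A / s\<^sup>2 = 1 / 2"
        using \<open>A > 0\<close> by (simp add: s2)
      finally have "A / s - 9 ^ d * A\<^sup>2 / s ^ 3 = A / (2 * s)" by simp
      also have "\<dots> = sqrt A / (2 * sqrt 2 * 3 ^ d)"
        using \<open>A > 0\<close> by (simp add: s_def real_sqrt_mult divide_simps)
      finally show ?thesis ..
    qed
    also have "\<dots> \<le> cube_mean V (\<lambda>x. (walsh_sum V a x)\<^sup>2) / s - cube_mean V (\<lambda>x. walsh_sum V a x ^ 4) / s ^ 3"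
      using walsh_fourth_moment[OF V deg] \<open>s > 0\<close>
      by (intro diff_mono divide_right_mono) (auto simp: walsh_second_moment[OF V] A_def)
    also have "\<dots> = cube_mean V (\<lambda>x. (walsh_sum V a x)\<^sup>2 / s - walsh_sum V a x ^ 4 / s ^ 3)"
      using cube_mean_cmult[of V "1 / s"] cube_mean_cmult[of V "1 / s ^ 3"]
      by (simp add: cube_mean_diff)
    also have "\<dots> \<le> cube_mean V (\<lambda>x. \<bar>walsh_sum V a x\<bar>)"
      by (intro cube_mean_mono pointwise)
    finally show ?thesis unfolding A_def .
  qed
qed

section \<open>Transversals of a partition into blocks\<close>

text \<open>
  A map \<open>\<beta>\<close> partitions \<open>V\<close> into the blocks \<open>\<beta> i = b\<close> for \<open>b \<in> M\<close>; a transversal picks one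
  element from each of them.
\<close>

definition transversals :: "('i \<Rightarrow> 'b) \<Rightarrow> 'i set \<Rightarrow> 'b set \<Rightarrow> 'i set set" where
  "transversals \<beta> V M = {S. S \<subseteq> V \<and> bij_betw \<beta> S M}"

text \<open>
  A transversal is the range of a unique choice function, so transversals are counted by the
  dependent function space.
\<close>

lemma card_transversals:
  assumes "finite M"
  shows "card (transversals \<beta> V M) = (\<Prod>b\<in>M. card {i \<in> V. \<beta> i = b})"
proof -
  let ?F = "PiE M (\<lambda>b. {i \<in> V. \<beta> i = b})"
  have "bij_betw (\<lambda>f. f ` M) ?F (transversals \<beta> V M)"
  proof (rule bij_betw_byWitness[where f' = "\<lambda>S. restrict (inv_into S \<beta>) M"])
    show "\<forall>f\<in>?F. restrict (inv_into (f ` M) \<beta>) M = f"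
    proof (intro ballI ext)
      fix f b assume f: "f \<in> ?F"
      have "inj_on \<beta> (f ` M)" using f by (intro inj_onI) (fastforce simp: PiE_iff)
      moreover have "\<beta> (f b) = b" if "b \<in> M" using f that by (auto simp: PiE_iff)
      ultimately show "restrict (inv_into (f ` M) \<beta>) M b = f b"
        using inv_into_f_f[of \<beta> "f ` M" "f b"] PiE_arb[OF f, of b] by (cases "b \<in> M") auto
    qed
    show "\<forall>S\<in>transversals \<beta> V M. restrict (inv_into S \<beta>) M ` M = S"
      using bij_betw_imp_surj_on[OF bij_betw_inv_into] by (force simp: transversals_def)
    show "(\<lambda>f. f ` M) ` ?F \<subseteq> transversals \<beta> V M"
    proof (intro image_subsetI)
      fix f assume f: "f \<in> ?F"
      then have "bij_betw \<beta> (f ` M) M"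
        by (intro bij_betw_byWitness[where f' = f]) (auto simp: PiE_iff)
      then show "f ` M \<in> transversals \<beta> V M"
        using f by (auto simp: transversals_def PiE_iff)
    qed
    show "(\<lambda>S. restrict (inv_into S \<beta>) M) ` transversals \<beta> V M \<subseteq> ?F"
    proof (intro image_subsetI)
      fix S assume S: "S \<in> transversals \<beta> V M"
      then have "\<beta> ` S = M" by (auto simp: transversals_def bij_betw_def)
      then show "restrict (inv_into S \<beta>) M \<in> ?F"
        using S inv_into_into[of _ \<beta> S] f_inv_into_f[of _ \<beta> S]
        by (auto simp: transversals_def PiE_iff)
    qed
  qed
  then show ?thesis using card_PiE[OF assms] bij_betw_same_card by metis
qed

text \<open>
  This is the decomposition behind \<open>Q = \<Sum>\<^sub>j z\<^sub>j Q\<^sub>j(x)\<close>: a transversal consists of its element \<open>j\<close> in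
  the distinguished block \<open>c\<close> and a transversal of the other blocks.
\<close>

lemma bij_betw_transversals_insert:
  assumes "c \<in> M"
  shows "bij_betw (\<lambda>(j, T). insert j T)
    ({i \<in> V. \<beta> i = c} \<times> transversals \<beta> {i \<in> V. \<beta> i \<noteq> c} (M - {c})) (transversals \<beta> V M)"
    (is "bij_betw ?h (?J \<times> ?T) _")
proof (rule bij_betwI')
  fix p p' assume "p \<in> ?J \<times> ?T" "p' \<in> ?J \<times> ?T"
  then obtain j T j' T' where p: "p = (j, T)" "p' = (j', T')"
    and j: "\<beta> j = c" "\<beta> j' = c" and T: "\<forall>i\<in>T. \<beta> i \<noteq> c" "\<forall>i\<in>T'. \<beta> i \<noteq> c"
    unfolding transversals_def by blast
  have "j = j' \<and> T = T'" if eq: "insert j T = insert j' T'"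
  proof -
    have "j \<in> insert j' T'" using eq by blast
    then have "j = j'" using j T by auto
    moreover have "j \<notin> T" "j' \<notin> T'" using j T by auto
    ultimately show ?thesis using eq by (metis insert_ident)
  qed
  then show "(?h p = ?h p') = (p = p')" using p by auto
next
  fix p assume "p \<in> ?J \<times> ?T"
  then obtain j T where p: "p = (j, T)" and "j \<in> V" "\<beta> j = c" and T: "T \<subseteq> {i \<in> V. \<beta> i \<noteq> c}"
    and "bij_betw \<beta> T (M - {c})"
    by (auto simp: transversals_def)
  then have "bij_betw \<beta> (insert j T) (insert c (M - {c}))"
    by (auto simp: bij_betw_def inj_on_insert)
  then show "?h p \<in> transversals \<beta> V M"
    using p \<open>j \<in> V\<close> T assms by (auto simp: transversals_def insert_absorb)
next
  fix S assume "S \<in> transversals \<beta> V M"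
  then have S: "S \<subseteq> V" "bij_betw \<beta> S M" by (auto simp: transversals_def)
  with assms obtain j where j: "j \<in> S" "\<beta> j = c" by (auto simp: bij_betw_def)
  have "bij_betw \<beta> (S - {j}) (M - {c})"
    using S j by (auto simp: bij_betw_def inj_on_def)
  then have "S - {j} \<in> ?T"
    using S j by (auto simp: transversals_def bij_betw_def inj_on_def)
  then show "\<exists>p\<in>?J \<times> ?T. S = ?h p"
    using S j by (intro bexI[of _ "(j, S - {j})"]) auto
qed

section \<open>Extracting the transversal part of a homogeneous polynomial\<close>

definition indicator_index :: "nat set \<Rightarrow> nat \<Rightarrow> nat" where
  "indicator_index S i = (if i \<in> S then 1 else 0)"

lemma monomial_indicator_index:
  assumes "S \<subseteq> {..<n}"
  shows "monomial n (indicator_index S) z = (\<Prod>i\<in>S. z i)"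
proof -
  have "(\<Prod>i<n. z i ^ indicator_index S i) = (\<Prod>i\<in>S. z i ^ indicator_index S i)"
    using assms by (intro prod.mono_neutral_right) (auto simp: indicator_index_def)
  then show ?thesis
    unfolding monomial_def by (simp add: indicator_index_def cong: prod.cong)
qed

lemma inj_indicator_index: "inj indicator_index"
  by (rule injI) (auto simp: indicator_index_def fun_eq_iff split: if_splits)

text \<open>
  If the degrees in all \<open>m\<close> blocks are odd, they are at least \<open>1\<close>; as they add up to \<open>m\<close>, each of
  them equals \<open>1\<close>. This is why averaging over block signs isolates the transversal monomials.
\<close>

lemma odd_block_degrees_eq:
  assumes "finite M" and M: "card M = m" and \<beta>: "\<beta> ` {..<n} \<subseteq> M"
  shows "{\<alpha> \<in> multi_indices n m. \<forall>b\<in>M. odd (\<Sum>i\<in>{i \<in> {..<n}. \<beta> i = b}. \<alpha> i)}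
       = indicator_index ` transversals \<beta> {..<n} M" (is "?L = ?R")
proof -
  define B where "B b = {i \<in> {..<n}. \<beta> i = b}" for b
  have sumB: "(\<Sum>b\<in>M. \<Sum>i\<in>B b. \<alpha> i) = (\<Sum>i<n. \<alpha> i)" for \<alpha> :: "nat \<Rightarrow> nat"
    unfolding B_def using assms by (intro sum.group) auto
  have "\<alpha> \<in> ?R" if "\<alpha> \<in> ?L" for \<alpha>
  proof -
    from that have supp: "\<And>i. i \<ge> n \<Longrightarrow> \<alpha> i = 0" and sum: "(\<Sum>i<n. \<alpha> i) = m"
      and odd: "\<And>b. b \<in> M \<Longrightarrow> odd (\<Sum>i\<in>B b. \<alpha> i)"
      by (auto simp: multi_indices_def B_def)
    have deg: "(\<Sum>i\<in>B b. \<alpha> i) = 1" if "b \<in> M" for b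
    proof (rule ccontr)
      assume "(\<Sum>i\<in>B b. \<alpha> i) \<noteq> 1"
      with odd[OF that] have "1 < (\<Sum>i\<in>B b. \<alpha> i)"
        by (cases "\<Sum>i\<in>B b. \<alpha> i") (auto simp del: sum_eq_0_iff)
      moreover have "1 \<le> (\<Sum>i\<in>B b. \<alpha> i)" if "b \<in> M" for b
        using odd[OF that] by (cases "\<Sum>i\<in>B b. \<alpha> i") (auto simp del: sum_eq_0_iff)
      ultimately have "(\<Sum>b\<in>M. 1) < (\<Sum>b\<in>M. \<Sum>i\<in>B b. \<alpha> i)"
        using that \<open>finite M\<close> by (intro sum_strict_mono_ex1) auto
      then show False using sumB sum M by simp
    qed
    define S where "S = {i \<in> {..<n}. \<alpha> i \<noteq> 0}"
    have fin: "finite (B b)" for b by (simp add: B_def)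
    have "\<alpha> i = 1" if "i \<in> S" for i
    proof -
      have "\<alpha> i \<le> (\<Sum>i\<in>B (\<beta> i). \<alpha> i)"
        using that fin by (intro member_le_sum) (auto simp: S_def B_def)
      moreover have "\<beta> i \<in> M" using that \<beta> by (auto simp: S_def)
      ultimately show ?thesis using deg that by (simp add: S_def)
    qed
    then have "\<alpha> = indicator_index S"
      using supp by (force simp: indicator_index_def S_def fun_eq_iff not_less)
    moreover have "bij_betw \<beta> S M"
      unfolding bij_betw_def
    proof
      show "inj_on \<beta> S"
      proof (rule inj_onI, rule ccontr)
        fix i j assume ij: "i \<in> S" "j \<in> S" "\<beta> i = \<beta> j" "i \<noteq> j"
        then have "(\<Sum>i\<in>{i, j}. \<alpha> i) \<le> (\<Sum>i\<in>B (\<beta> i). \<alpha> i)"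
          using fin by (intro sum_mono2) (auto simp: S_def B_def)
        moreover have "\<beta> i \<in> M" using ij \<beta> by (auto simp: S_def)
        ultimately show False using deg ij by (simp add: S_def)
      qed
      have "b \<in> \<beta> ` S" if b: "b \<in> M" for b
      proof -
        have "\<exists>i\<in>B b. \<alpha> i \<noteq> 0"
          using deg[OF b] by (metis sum.neutral zero_neq_one)
        then show ?thesis by (auto simp: S_def B_def)
      qed
      then show "\<beta> ` S = M" using \<beta> by (auto simp: S_def)
    qed
    ultimately show ?thesis by (auto simp: transversals_def S_def)
  qed
  moreover have "indicator_index S \<in> ?L" if "S \<in> transversals \<beta> {..<n} M" for S
  proof -
    from that have S: "S \<subseteq> {..<n}" "inj_on \<beta> S" "\<beta> ` S = M"
      by (auto simp: transversals_def bij_betw_def)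
    have deg: "(\<Sum>i\<in>B b. indicator_index S i) = 1" if "b \<in> M" for b
    proof -
      obtain j where j: "j \<in> S" "\<beta> j = b" using S \<open>b \<in> M\<close> by auto
      have "(\<Sum>i\<in>B b. indicator_index S i) = (\<Sum>i\<in>{j}. indicator_index S i)"
        using S j by (intro sum.mono_neutral_right) (auto simp: B_def indicator_index_def inj_on_def)
      then show ?thesis using j by (simp add: indicator_index_def)
    qed
    have "(\<Sum>i<n. indicator_index S i) = m"
      using M by (simp add: sumB[symmetric] deg)
    then show ?thesis
      using S deg by (auto simp: multi_indices_def B_def indicator_index_def)
  qed
  ultimately show ?thesis by blast
qed

text \<open>
  The transversal part of \<open>P\<close> is the average of \<open>s\<^sub>1 \<cdots> s\<^sub>m P(s \<cdot> z)\<close> over block signs \<open>s\<close>, that is,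
  an average of numbers of absolute value at most \<open>K\<close>. In contrast to extracting a homogeneous part by
  interpolation, this costs no constant.
\<close>

lemma transversal_part_bound:
  fixes \<epsilon> :: "(nat \<Rightarrow> nat) \<Rightarrow> real"
  assumes "finite M" and M: "card M = m" and \<beta>: "\<beta> ` {..<n} \<subseteq> M"
    and bound: "\<And>y. (\<And>i. i < n \<Longrightarrow> \<bar>y i\<bar> \<le> 1) \<Longrightarrow> \<bar>hom_poly m n \<epsilon> y\<bar> \<le> K"
    and z: "\<And>i. i < n \<Longrightarrow> \<bar>z i\<bar> \<le> 1"
  shows "\<bar>\<Sum>S\<in>transversals \<beta> {..<n} M. \<epsilon> (indicator_index S) * (\<Prod>i\<in>S. z i)\<bar> \<le> K"
proof -
  define deg where "deg \<alpha> b = (\<Sum>i\<in>{i \<in> {..<n}. \<beta> i = b}. \<alpha> i)" for \<alpha> :: "nat \<Rightarrow> nat" and b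
  define f where "f s = (\<Prod>b\<in>M. s b) * hom_poly m n \<epsilon> (\<lambda>i. s (\<beta> i) * z i)" for s :: "'a \<Rightarrow> real"
  have monom: "monomial n \<alpha> (\<lambda>i. s (\<beta> i) * z i) = (\<Prod>b\<in>M. s b ^ deg \<alpha> b) * monomial n \<alpha> z"
    for s :: "'a \<Rightarrow> real" and \<alpha>
  proof -
    have "(\<Prod>b\<in>M. s b ^ deg \<alpha> b) = (\<Prod>b\<in>M. \<Prod>i\<in>{i \<in> {..<n}. \<beta> i = b}. s (\<beta> i) ^ \<alpha> i)"
      unfolding deg_def by (intro prod.cong) (auto simp: power_sum)
    also have "\<dots> = (\<Prod>i<n. s (\<beta> i) ^ \<alpha> i)"
      using assms by (intro prod.group) auto
    finally show ?thesis by (simp add: monomial_def power_mult_distrib prod.distrib)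
  qed
  have "cube_mean M f = cube_mean M (\<lambda>s. \<Sum>\<alpha>\<in>multi_indices n m.
      \<epsilon> \<alpha> * monomial n \<alpha> z * (\<Prod>b\<in>M. s b ^ Suc (deg \<alpha> b)))"
    unfolding f_def hom_poly_def monom by (simp add: sum_distrib_left prod.distrib mult_ac)
  also have "\<dots> = (\<Sum>\<alpha>\<in>multi_indices n m. if \<forall>b\<in>M. odd (deg \<alpha> b) then \<epsilon> \<alpha> * monomial n \<alpha> z else 0)"
    unfolding cube_mean_sum cube_mean_cmult cube_mean_monomial[OF \<open>finite M\<close>]
    by (intro sum.cong) auto
  also have "\<dots> = (\<Sum>\<alpha>\<in>indicator_index ` transversals \<beta> {..<n} M. \<epsilon> \<alpha> * monomial n \<alpha> z)"
    unfolding odd_block_degrees_eq[OF assms(1-3), symmetric] deg_def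
    by (simp add: sum.inter_filter finite_multi_indices)
  also have "\<dots> = (\<Sum>S\<in>transversals \<beta> {..<n} M. \<epsilon> (indicator_index S) * (\<Prod>i\<in>S. z i))"
    by (subst sum.reindex[OF inj_on_subset[OF inj_indicator_index]])
       (auto intro!: sum.cong simp: monomial_indicator_index transversals_def)
  finally have "cube_mean M f = \<dots>" .
  moreover have "\<bar>cube_mean M f\<bar> \<le> K"
  proof (rule cube_mean_abs_le[OF \<open>finite M\<close>])
    fix s :: "'a \<Rightarrow> real" assume s: "\<And>b. s b = 1 \<or> s b = -1"
    then have abs: "\<bar>s b\<bar> = 1" for b by (metis abs_minus_cancel abs_one)
    then have "\<bar>\<Prod>b\<in>M. s b\<bar> = 1" by (simp add: abs_prod)
    moreover have "\<bar>hom_poly m n \<epsilon> (\<lambda>i. s (\<beta> i) * z i)\<bar> \<le> K"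
      using abs z by (intro bound) (simp add: abs_mult)
    ultimately show "\<bar>f s\<bar> \<le> K" by (simp add: f_def abs_mult)
  qed
  ultimately show ?thesis by simp
qed

section \<open>The lower bound for sign polynomials\<close>

text \<open>
  Here \<open>walsh_sum V (a j)\<close> is the coefficient \<open>Q\<^sub>j\<close> of \<open>z\<^sub>j\<close> in the transversal part. It has degree \<open>d\<close>,
  and all its nonzero coefficients are signs, so its second moment is the number of transversals of
  the blocks other than \<open>c\<close>.
\<close>

lemma sup_norm_lower_bound:
  fixes \<epsilon> :: "(nat \<Rightarrow> nat) \<Rightarrow> real"
  assumes "finite M" and M: "card M = Suc d" and \<beta>: "\<beta> ` {..<n} \<subseteq> M" and c: "c \<in> M"
    and bound: "\<And>y. (\<And>i. i < n \<Longrightarrow> \<bar>y i\<bar> \<le> 1) \<Longrightarrow> \<bar>hom_poly (Suc d) n \<epsilon> y\<bar> \<le> K"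
    and \<epsilon>: "\<And>\<alpha>. \<alpha> \<in> multi_indices n (Suc d) \<Longrightarrow> \<epsilon> \<alpha> \<in> {-1, 1}"
  shows "real (card {i \<in> {..<n}. \<beta> i = c})
      * sqrt (\<Prod>b\<in>M - {c}. real (card {i \<in> {..<n}. \<beta> i = b})) / (2 * sqrt 2 * 3 ^ d) \<le> K"
proof -
  define J V where "J = {i \<in> {..<n}. \<beta> i = c}" and "V = {i \<in> {..<n}. \<beta> i \<noteq> c}"
  define R where "R = transversals \<beta> V (M - {c})"
  define a where "a j T = (if T \<in> R then \<epsilon> (indicator_index (insert j T)) else 0)" for j T
  have fin: "finite J" "finite V" by (auto simp: J_def V_def)
  have R: "R \<subseteq> Pow V" by (auto simp: R_def transversals_def)
  have bij: "bij_betw (\<lambda>(j, T). insert j T) (J \<times> R) (transversals \<beta> {..<n} M)"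
    unfolding J_def R_def V_def by (rule bij_betw_transversals_insert[OF c])
  have walsh: "walsh_sum V (a j) x = (\<Sum>T\<in>R. \<epsilon> (indicator_index (insert j T)) * (\<Prod>i\<in>T. x i))" for j x
    unfolding walsh_sum_def a_def using R fin
    by (intro sum.mono_neutral_cong_right) auto
  have upper: "(\<Sum>j\<in>J. \<bar>walsh_sum V (a j) x\<bar>) \<le> K" if x: "\<And>i. x i = 1 \<or> x i = -1" for x
  proof -
    \<comment> \<open>The signs in block \<open>c\<close> align all terms, which makes the transversal part equal to the sum.\<close>
    define z where "z i = (if i \<in> J then sgn (walsh_sum V (a i) x) else x i)" for i
    have abs_x: "\<bar>x i\<bar> = 1" for i using x by (metis abs_minus_cancel abs_one)
    have "(\<Sum>S\<in>transversals \<beta> {..<n} M. \<epsilon> (indicator_index S) * (\<Prod>i\<in>S. z i))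
        = (\<Sum>(j, T)\<in>J \<times> R. \<epsilon> (indicator_index (insert j T)) * (\<Prod>i\<in>insert j T. z i))"
      by (subst sum.reindex_bij_betw[OF bij, symmetric]) (simp add: case_prod_unfold)
    also have "\<dots> = (\<Sum>j\<in>J. \<Sum>T\<in>R. \<epsilon> (indicator_index (insert j T)) * (z j * (\<Prod>i\<in>T. x i)))"
      unfolding sum.cartesian_product[symmetric]
    proof (intro sum.cong refl)
      fix j T assume j: "j \<in> J" and "T \<in> R"
      then have T: "T \<subseteq> V" using R by auto
      then have "finite T" "j \<notin> T" "T \<inter> J = {}"
        using j finite_subset[OF T fin(2)] by (auto simp: V_def J_def)
      then have "(\<Prod>i\<in>insert j T. z i) = z j * (\<Prod>i\<in>T. x i)"
        by (auto simp: z_def intro!: prod.cong)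
      then show "\<epsilon> (indicator_index (insert j T)) * (\<Prod>i\<in>insert j T. z i)
          = \<epsilon> (indicator_index (insert j T)) * (z j * (\<Prod>i\<in>T. x i))" by simp
    qed
    also have "\<dots> = (\<Sum>j\<in>J. z j * walsh_sum V (a j) x)"
      by (simp add: walsh sum_distrib_left mult_ac)
    also have "\<dots> = (\<Sum>j\<in>J. \<bar>walsh_sum V (a j) x\<bar>)"
      by (intro sum.cong) (auto simp: z_def sgn_mult_abs abs_sgn mult.commute)
    finally have "(\<Sum>S\<in>transversals \<beta> {..<n} M. \<epsilon> (indicator_index S) * (\<Prod>i\<in>S. z i)) = \<dots>" .
    moreover have "\<bar>\<Sum>S\<in>transversals \<beta> {..<n} M. \<epsilon> (indicator_index S) * (\<Prod>i\<in>S. z i)\<bar> \<le> K"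
      by (rule transversal_part_bound[OF \<open>finite M\<close> M \<beta> bound]) (auto simp: z_def abs_x abs_sgn_eq)
    ultimately show ?thesis by (simp add: abs_le_iff)
  qed
  have lower: "sqrt (card R) / (2 * sqrt 2 * 3 ^ d) \<le> cube_mean V (\<lambda>x. \<bar>walsh_sum V (a j) x\<bar>)" if "j \<in> J" for j
  proof -
    have "(a j T)\<^sup>2 = 1" if "T \<in> R" for T
    proof -
      have "insert j T \<in> transversals \<beta> {..<n} M"
        using bij_betwE[OF bij] \<open>j \<in> J\<close> that by auto
      then have "indicator_index (insert j T) \<in> multi_indices n (Suc d)"
        using odd_block_degrees_eq[OF \<open>finite M\<close> M \<beta>] by auto
      then show ?thesis using \<epsilon>[of "indicator_index (insert j T)"] that by (auto simp: a_def)
    qed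
    then have "(\<Sum>T\<in>Pow V. (a j T)\<^sup>2) = (\<Sum>T\<in>R. 1)"
      using R fin by (intro sum.mono_neutral_cong_right) (auto simp: a_def)
    moreover have "a j T = 0" if "card T > d" for T
    proof -
      have "card T = d" if "T \<in> R"
        using that bij_betw_same_card[of \<beta> T "M - {c}"] M c
        by (simp add: R_def transversals_def)
      then show ?thesis using that by (auto simp: a_def)
    qed
    ultimately show ?thesis
      using walsh_first_moment[OF fin(2), of d "a j"] by simp
  qed
  have "card R = (\<Prod>b\<in>M - {c}. card {i \<in> {..<n}. \<beta> i = b})"
    unfolding R_def using \<open>finite M\<close> by (subst card_transversals)
      (auto simp: V_def intro!: prod.cong arg_cong[where f = card])
  then have "real (card J) * sqrt (\<Prod>b\<in>M - {c}. real (card {i \<in> {..<n}. \<beta> i = b})) / (2 * sqrt 2 * 3 ^ d)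
      = (\<Sum>j\<in>J. sqrt (card R) / (2 * sqrt 2 * 3 ^ d))"
    by simp
  also have "\<dots> \<le> (\<Sum>j\<in>J. cube_mean V (\<lambda>x. \<bar>walsh_sum V (a j) x\<bar>))"
    by (intro sum_mono lower)
  also have "\<dots> = cube_mean V (\<lambda>x. \<Sum>j\<in>J. \<bar>walsh_sum V (a j) x\<bar>)"
    by (simp add: cube_mean_sum)
  also have "\<dots> \<le> cube_mean V (\<lambda>_. K)"
    by (intro cube_mean_mono upper)
  also have "\<dots> = K" by (rule cube_mean_const[OF fin(2)])
  finally show ?thesis unfolding J_def .
qed

text \<open>
  With \<open>m\<close> blocks of equal size \<open>k\<close>, given by \<open>i div k\<close>, the bound becomes
  \<open>k \<cdot> (k\<^bsup>m-1\<^esup>)\<^bsup>1/2\<^esup>\<close> up to the factor depending on \<open>m\<close>.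
\<close>

lemma sup_norm_lower_bound_powr:
  fixes \<epsilon> :: "(nat \<Rightarrow> nat) \<Rightarrow> real"
  assumes "m \<ge> 1" "k \<ge> 1"
    and bound: "\<And>y. (\<And>i. i < m * k \<Longrightarrow> \<bar>y i\<bar> \<le> 1) \<Longrightarrow> \<bar>hom_poly m (m * k) \<epsilon> y\<bar> \<le> K"
    and \<epsilon>: "\<And>\<alpha>. \<alpha> \<in> multi_indices (m * k) m \<Longrightarrow> \<epsilon> \<alpha> \<in> {-1, 1}"
  shows "real k powr ((real m + 1) / 2) / (2 * sqrt 2 * 3 ^ (m - 1)) \<le> K"
proof -
  obtain d where m: "m = Suc d" using \<open>m \<ge> 1\<close> by (cases m) auto
  have block: "card {i \<in> {..<m * k}. i div k = b} = k" if "b < m" for b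
  proof -
    have "{i \<in> {..<m * k}. i div k = b} = {b * k..<b * k + k}"
    proof (intro set_eqI iffI)
      fix i assume "i \<in> {b * k..<b * k + k}"
      moreover have "b * k + k \<le> m * k" using that by (metis Suc_leI add.commute mult_Suc mult_le_mono1)
      ultimately show "i \<in> {i \<in> {..<m * k}. i div k = b}"
        using \<open>k \<ge> 1\<close> by (auto intro!: div_nat_eqI simp: mult.commute)
    qed (use \<open>k \<ge> 1\<close> dividend_less_times_div[of k] in \<open>auto simp: mult.commute add.commute\<close>)
    then show ?thesis by simp
  qed
  have "real k * sqrt (\<Prod>b\<in>{..<m} - {d}. real (card {i \<in> {..<m * k}. i div k = b})) / (2 * sqrt 2 * 3 ^ d) \<le> K"
    using sup_norm_lower_bound[of "{..<m}" d "\<lambda>i. i div k" "m * k" d \<epsilon> K] bound \<epsilon> \<open>k \<ge> 1\<close> block[of d]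
    by (auto simp: m less_mult_imp_div_less image_subset_iff)
  also have "(\<Prod>b\<in>{..<m} - {d}. real (card {i \<in> {..<m * k}. i div k = b})) = (\<Prod>b\<in>{..<m} - {d}. real k)"
    using block by (intro prod.cong) auto
  also have "\<dots> = real k powr real d"
    using \<open>k \<ge> 1\<close> by (simp add: m powr_realpow)
  also have "real k * sqrt (real k powr real d) = real k powr 1 * real k powr (real d / 2)"
    using \<open>k \<ge> 1\<close> by (simp add: powr_half_sqrt[symmetric] powr_powr)
  also have "\<dots> = real k powr ((real m + 1) / 2)"
    unfolding powr_add[symmetric] by (simp add: m add_divide_distrib)
  finally show ?thesis by (simp add: m)
qed

text \<open>
  Along \<open>n = m k\<close>, a bound of order \<open>n\<^sup>q\<close> would make \<open>k\<close> to the positive power \<open>(m + 1) / 2 - q\<close>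
  bounded in \<open>k\<close>.
\<close>

lemma no_uniform_bound:
  fixes \<epsilon> :: "nat \<Rightarrow> (nat \<Rightarrow> nat) \<Rightarrow> real"
  assumes "m \<ge> 1" and q: "q < (real m + 1) / 2"
    and bound: "\<And>n y. n \<ge> 1 \<Longrightarrow> (\<And>i. i < n \<Longrightarrow> \<bar>y i\<bar> \<le> 1) \<Longrightarrow> \<bar>hom_poly m n (\<epsilon> n) y\<bar> \<le> D * real n powr q"
    and \<epsilon>: "\<And>n \<alpha>. n \<ge> 1 \<Longrightarrow> \<alpha> \<in> multi_indices n m \<Longrightarrow> \<epsilon> n \<alpha> \<in> {-1, 1}"
  shows False
proof -
  define p E where "p = (real m + 1) / 2 - q" and "E = D * real m powr q * (2 * sqrt 2 * 3 ^ (m - 1))"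
  have "p > 0" using q by (simp add: p_def)
  have bounded: "real k powr p \<le> E" if "k \<ge> 1" for k :: nat
  proof -
    have "real k powr ((real m + 1) / 2) / (2 * sqrt 2 * 3 ^ (m - 1)) \<le> D * real (m * k) powr q"
      using assms that by (intro sup_norm_lower_bound_powr[of m k "\<epsilon> (m * k)"] bound \<epsilon>) auto
    then have "real k powr ((real m + 1) / 2) \<le> D * real (m * k) powr q * (2 * sqrt 2 * 3 ^ (m - 1))"
      by (simp add: pos_divide_le_eq)
    also have "\<dots> = E * real k powr q"
      by (simp add: E_def powr_mult mult_ac)
    also have "(real m + 1) / 2 = p + q" by (simp add: p_def)
    finally show ?thesis using that by (simp add: powr_add)
  qed
  obtain k :: nat where k: "real k > max 1 E powr (1 / p)" using reals_Archimedean2 by blast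
  moreover have "1 \<le> max 1 E powr (1 / p)" using \<open>p > 0\<close> by (intro ge_one_powr_ge_zero) auto
  ultimately have "k \<ge> 1" by simp
  have "E \<le> max 1 E" by simp
  also have "\<dots> = (max 1 E powr (1 / p)) powr p" using \<open>p > 0\<close> by (simp add: powr_powr)
  also have "\<dots> < real k powr p" using k \<open>p > 0\<close> by (intro powr_less_mono2) auto
  finally show False using bounded[OF \<open>k \<ge> 1\<close>] by simp
qed

lemma norm_hom_poly_le_poly_norm:
  fixes c :: "(nat \<Rightarrow> nat) \<Rightarrow> 'a::real_normed_field"
  assumes "n \<ge> 1" "\<And>i. i < n \<Longrightarrow> norm (z i) \<le> 1"
  shows "norm (hom_poly m n c z) \<le> poly_norm n (hom_poly m n c)"
  unfolding poly_norm_def using assms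
  by (intro cSup_upper bdd_above_hom_poly) (auto simp: linf_norm_le_iff)

text \<open>
  Over an arbitrary normed field the coefficients \<open>\<plusminus>1\<close> come from real signs, and evaluating at real
  points reduces the claim to the real cube.
\<close>

lemma sign_poly_norm_not_bounded:
  assumes "m \<ge> 1" and "q < (real m + 1) / 2"
  shows "\<not> (\<forall>n\<ge>1. \<exists>\<epsilon> :: (nat \<Rightarrow> nat) \<Rightarrow> 'a::real_normed_field.
        (\<forall>\<alpha>\<in>multi_indices n m. \<epsilon> \<alpha> \<in> {-1, 1}) \<and>
        poly_norm n (hom_poly m n \<epsilon>) \<le> D * real n powr q)"
proof
  assume "\<forall>n\<ge>1. \<exists>\<epsilon> :: (nat \<Rightarrow> nat) \<Rightarrow> 'a. (\<forall>\<alpha>\<in>multi_indices n m. \<epsilon> \<alpha> \<in> {-1, 1}) \<and>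
        poly_norm n (hom_poly m n \<epsilon>) \<le> D * real n powr q"
  then obtain \<epsilon> :: "nat \<Rightarrow> (nat \<Rightarrow> nat) \<Rightarrow> 'a" where
    sign: "\<And>n \<alpha>. n \<ge> 1 \<Longrightarrow> \<alpha> \<in> multi_indices n m \<Longrightarrow> \<epsilon> n \<alpha> \<in> {-1, 1}" and
    bound: "\<And>n. n \<ge> 1 \<Longrightarrow> poly_norm n (hom_poly m n (\<epsilon> n)) \<le> D * real n powr q"
    by metis
  define \<delta> where "\<delta> n \<alpha> = (if \<epsilon> n \<alpha> = 1 then 1 else -1 :: real)" for n \<alpha>
  show False
  proof (rule no_uniform_bound[OF assms, where \<epsilon> = \<delta> and D = D])
    fix n :: nat and y :: "nat \<Rightarrow> real"
    assume n: "n \<ge> 1" and y: "\<And>i. i < n \<Longrightarrow> \<bar>y i\<bar> \<le> 1"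
    have "of_real (\<delta> n \<alpha>) = \<epsilon> n \<alpha>" if "\<alpha> \<in> multi_indices n m" for \<alpha>
      using sign[OF n that] by (auto simp: \<delta>_def)
    then have "hom_poly m n (\<epsilon> n) (\<lambda>i. of_real (y i)) = of_real (hom_poly m n (\<delta> n) y)"
      by (simp add: hom_poly_def monomial_def)
    then have "\<bar>hom_poly m n (\<delta> n) y\<bar> = norm (hom_poly m n (\<epsilon> n) (\<lambda>i. of_real (y i)))"
      by simp
    also have "\<dots> \<le> poly_norm n (hom_poly m n (\<epsilon> n))"
      using n y by (intro norm_hom_poly_le_poly_norm) auto
    also have "\<dots> \<le> D * real n powr q" by (rule bound[OF n])
    finally show "\<bar>hom_poly m n (\<delta> n) y\<bar> \<le> D * real n powr q" .
  qed (auto simp: \<delta>_def)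
qed

theorem theorem10p4:
  fixes m :: nat and q :: real
  assumes "m \<ge> 2" and "q < (real m + 1) / 2"
  shows
    "(\<not> (\<exists>C>0. \<forall>n\<ge>1. \<exists>\<epsilon> :: (nat \<Rightarrow> nat) \<Rightarrow> real.
        (\<forall>\<alpha>\<in>multi_indices n m. \<epsilon> \<alpha> \<in> {-1, 1}) \<and>
        poly_norm n (hom_poly m n \<epsilon>) \<le> C * real n powr q * sqrt (ln (real m)))) \<and>
     (\<not> (\<exists>C>0. \<forall>n\<ge>1. \<exists>\<epsilon> :: (nat \<Rightarrow> nat) \<Rightarrow> complex.
        (\<forall>\<alpha>\<in>multi_indices n m. \<epsilon> \<alpha> \<in> {-1, 1}) \<and>
        poly_norm n (hom_poly m n \<epsilon>) \<le> C * real n powr q * sqrt (ln (real m))))"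
proof -
  have "m \<ge> 1" using assms(1) by simp
  note not_bounded = sign_poly_norm_not_bounded[OF \<open>m \<ge> 1\<close> assms(2)]
  have factor: "C * x * sqrt (ln (real m)) = (C * sqrt (ln (real m))) * x" for C x :: real
    by simp
  show ?thesis
    unfolding factor using not_bounded[where ?'a = real] not_bounded[where ?'a = complex] by blast
qed

end
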